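(* Let $n\ge 1$ be an integer and let $A\subseteq\mathbb{Z}_{\ge 0}^n$ be a finite, non-empty downset. Then $$\frac{1}{|A|}\sum_{a\in A} w(a)\le \frac12\log_2|A|.$$
   Context: $\mathbb{Z}_{\ge0}$ is the set of non-negative integers. A set $A\subseteq\mathbb{Z}_{\ge0}^n$ is a downset if for every $a\in A$ and every $z\in\mathbb{Z}_{\ge0}^n$ with $z\le a$ coordinate-wise, $z\in A$. The weight $w(z)$ of a vector $z\in\mathbb{Z}^n$ is the number of its non-zero coordinates. *)

theory Defs
  imports Complex_Main "HOL-Library.FuncSet"
begin

text \<open>
  A vector of length \<open>n\<close> is a function on the index set \<open>{..<n}\<close>, extended by
  \<open>undefined\<close> outside it, so that distinct functions are distinct vectors and
  cardinalities of sets of vectors are the intended ones.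
\<close>

definition nonneg_vectors :: "nat \<Rightarrow> (nat \<Rightarrow> nat) set" where
  "nonneg_vectors n = ({..<n} \<rightarrow>\<^sub>E UNIV)"

definition is_downset :: "nat \<Rightarrow> (nat \<Rightarrow> nat) set \<Rightarrow> bool" where
  "is_downset n A \<longleftrightarrow> A \<subseteq> nonneg_vectors n \<and>
     (\<forall>a\<in>A. \<forall>z\<in>nonneg_vectors n. (\<forall>i<n. z i \<le> a i) \<longrightarrow> z \<in> A)"

definition weight :: "nat \<Rightarrow> (nat \<Rightarrow> 'a::zero) \<Rightarrow> nat" where
  "weight n z = card {i. i < n \<and> z i \<noteq> 0}"

end

theory Submission
  imports Defs "HOL-Analysis.Convex"
begin

text \<open>
  Induct on \<open>card A\<close>. Unless all weights vanish, some coordinate \<open>i\<close> attains a maximum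
  \<open>k > 0\<close> on \<open>A\<close>. Split off the top layer \<open>B = {a \<in> A. a i = k}\<close>. Setting the \<open>i\<close>-th
  coordinate to zero maps \<open>B\<close> injectively onto a downset contained in the downset \<open>A - B\<close>, at
  the cost of one unit of weight per element. Hence \<open>b = card B\<close> is at most
  \<open>c = card (A - B)\<close>, and the induction closes because \<open>f x = x log x\<close> (base 2) satisfies
  \<open>f (b + c) \<ge> f b + f c + 2 b\<close>.
\<close>

text \<open>Concavity of the logarithm: the chord through the points at 0 and 1 lies below the
  graph. Exponentiated, this is weighted AM-GM for 1 and 2 with weights \<open>1 - t\<close> and
  \<open>t\<close>.\<close>

lemma log2_one_plus_ge:
  fixes t :: real
  assumes "0 \<le> t" "t \<le> 1"
  shows "t \<le> log 2 (1 + t)"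
proof -
  have "1 powr (1 - t) * 2 powr t \<le> (1 - t) * 1 + t * 2"
    using assms by (intro Youngs_inequality_0) auto
  then have "2 powr t \<le> 1 + t" by simp
  then show ?thesis using assms by (simp add: le_log_iff)
qed

text \<open>The gain is the sum of \<open>b * (log 2 (b + c) - log 2 b)\<close> and
  \<open>c * (log 2 (b + c) - log 2 c)\<close>. Each is at least \<open>b\<close>: the first because
  \<open>b + c \<ge> 2 * b\<close>, the second by the chord bound at
  \<open>t = b / c\<close>.\<close>

lemma mult_log2_superadditive:
  fixes b c :: real
  assumes "0 < b" "b \<le> c"
  shows "b * log 2 b + c * log 2 c + 2 * b \<le> (b + c) * log 2 (b + c)"
proof -
  have "b / c \<le> log 2 (1 + b / c)"
    using assms by (intro log2_one_plus_ge) auto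
  also have "1 + b / c = (b + c) / c"
    using assms by (simp add: field_simps)
  also have "log 2 ((b + c) / c) = log 2 (b + c) - log 2 c"
    using assms by (simp add: log_divide)
  finally have "b \<le> c * (log 2 (b + c) - log 2 c)"
    using assms by (simp add: field_simps)
  moreover have "log 2 (2 * b) \<le> log 2 (b + c)"
    using assms by simp
  then have "b * (1 + log 2 b) \<le> b * log 2 (b + c)"
    using assms by (simp add: log_mult)
  ultimately show ?thesis by (simp add: algebra_simps)
qed

lemma nonneg_vectors_upd:
  "a \<in> nonneg_vectors n \<Longrightarrow> i < n \<Longrightarrow> a(i := x) \<in> nonneg_vectors n"
  by (auto simp: nonneg_vectors_def PiE_def extensional_def)

lemma weight_upd_zero:
  assumes "i < n" "a i \<noteq> 0"
  shows "weight n a = Suc (weight n (a(i := 0)))"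
proof -
  have "{j. j < n \<and> a j \<noteq> 0} = insert i {j. j < n \<and> (a(i := 0)) j \<noteq> 0}"
    using assms by auto
  then show ?thesis by (simp add: weight_def)
qed

lemma downset_upd_zero:
  assumes "is_downset n A" "a \<in> A" "i < n"
  shows "a(i := 0) \<in> A"
proof -
  have "a(i := 0) \<in> nonneg_vectors n"
    using assms by (auto simp: is_downset_def intro: nonneg_vectors_upd)
  with assms show ?thesis unfolding is_downset_def by (metis fun_upd_apply le_refl zero_le)
qed

lemma downset_below_layer:
  assumes "is_downset n A" "i < n"
  shows "is_downset n {a \<in> A. a i < k}"
  using assms unfolding is_downset_def by (blast intro: le_less_trans)

text \<open>A vector below a projected one lifts back to the layer by restoring the value
  \<open>k\<close> at \<open>i\<close>; the lift is still below a member of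
  \<open>A\<close>.\<close>

lemma downset_layer_projection:
  assumes A: "is_downset n A" and i: "i < n"
  shows "is_downset n ((\<lambda>a. a(i := 0)) ` {a \<in> A. a i = k})"
  unfolding is_downset_def
proof (intro conjI ballI impI)
  show "(\<lambda>a. a(i := 0)) ` {a \<in> A. a i = k} \<subseteq> nonneg_vectors n"
    using A i by (auto simp: is_downset_def intro: nonneg_vectors_upd)
next
  fix y z
  assume "y \<in> (\<lambda>a. a(i := 0)) ` {a \<in> A. a i = k}" and z: "z \<in> nonneg_vectors n"
    and le: "\<forall>j<n. z j \<le> y j"
  then obtain a where a: "a \<in> A" "a i = k" "y = a(i := 0)" by auto
  have "z i = 0" using le a(3) i by fastforce
  have "\<forall>j<n. (z(i := k)) j \<le> a j" using le a by auto
  then have "z(i := k) \<in> A"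
    using A a(1) nonneg_vectors_upd[OF z i] unfolding is_downset_def by blast
  moreover have "z = (z(i := k))(i := 0)" using \<open>z i = 0\<close> by auto
  ultimately show "z \<in> (\<lambda>a. a(i := 0)) ` {a \<in> A. a i = k}"
    by (intro image_eqI[of _ _ "z(i := k)"]) auto
qed

text \<open>With the denominator cleared, the bounds for the two pieces of \<open>A\<close> can
  simply be added.\<close>

lemma sum_weight_downset_le:
  assumes "finite A" "A \<noteq> {}" "is_downset n A"
  shows "2 * (\<Sum>a\<in>A. real (weight n a)) \<le> real (card A) * log 2 (real (card A))"
  using assms
proof (induction "card A" arbitrary: A rule: less_induct)
  case less
  note fin = less.prems(1) and ne = less.prems(2) and down = less.prems(3)
  show ?case
  proof (cases "\<exists>i<n. \<exists>a\<in>A. a i \<noteq> 0")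
    case False
    then have "\<And>a. a \<in> A \<Longrightarrow> weight n a = 0" by (auto simp: weight_def)
    \<comment> \<open>The weight sum is 0, so it suffices that the logarithm is nonnegative.\<close>
    moreover have "1 \<le> card A" using fin ne by (simp add: Suc_le_eq card_gt_0_iff)
    ultimately show ?thesis by simp
  next
    case True
    then obtain i a0 where i: "i < n" and a0: "a0 \<in> A" "a0 i \<noteq> 0" by blast
    define k where "k = Max ((\<lambda>a. a i) ` A)"
    define B where "B = {a \<in> A. a i = k}"
    define C where "C = {a \<in> A. a i < k}"
    define B' where "B' = (\<lambda>a. a(i := 0)) ` B"
    have le_k: "a i \<le> k" if "a \<in> A" for a
      unfolding k_def using fin that by simp
    with a0 have k: "k > 0" by fastforce
    have "k \<in> (\<lambda>a. a i) ` A"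
      unfolding k_def using fin ne by (intro Max_in) auto
    then have Bne: "B \<noteq> {}" by (auto simp: B_def)
    have union: "A = B \<union> C" using le_k by (auto simp: B_def C_def le_less)
    have disj: "B \<inter> C = {}" by (auto simp: B_def C_def)
    have finB: "finite B" and finC: "finite C" using fin by (simp_all add: B_def C_def)
    have inj: "inj_on (\<lambda>a. a(i := 0)) B"
      by (rule inj_onI) (metis (mono_tags, lifting) B_def fun_upd_triv fun_upd_upd mem_Collect_eq)
    \<comment> \<open>Zeroing keeps a vector in \<open>A\<close> and puts its \<open>i\<close>-th
      coordinate below \<open>k\<close>, as \<open>k > 0\<close>.\<close>
    have B'C: "B' \<subseteq> C"
      using downset_upd_zero[OF down _ i] k by (auto simp: B'_def B_def C_def)
    have Cne: "C \<noteq> {}" using B'C Bne by (auto simp: B'_def)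
    have cardB': "card B' = card B" unfolding B'_def by (rule card_image[OF inj])
    have bc: "card B \<le> card C" using card_mono[OF finC B'C] cardB' by simp
    have b: "0 < card B" and c: "0 < card C"
      using finB finC Bne Cne by (simp_all add: card_gt_0_iff)
    have cardA: "card A = card B + card C"
      unfolding union by (rule card_Un_disjoint[OF finB finC disj])
    \<comment> \<open>Since \<open>B\<close> and \<open>C\<close> are both nonempty,
      \<open>C\<close> and \<open>B'\<close> are strictly smaller than \<open>A\<close>.\<close>
    have IHC: "2 * (\<Sum>a\<in>C. real (weight n a)) \<le> real (card C) * log 2 (real (card C))"
      using less.hyps[of C] cardA b finC Cne downset_below_layer[OF down i]
      by (simp add: C_def)
    have IHB: "2 * (\<Sum>a\<in>B'. real (weight n a)) \<le> real (card B) * log 2 (real (card B))"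
      using less.hyps[of B'] cardA c cardB' finB Bne downset_layer_projection[OF down i, of k]
      by (simp add: B'_def B_def)
    have "(\<Sum>a\<in>B. real (weight n a)) = (\<Sum>a\<in>B. real (weight n (a(i := 0))) + 1)"
      using k i by (intro sum.cong) (auto simp: B_def weight_upd_zero)
    also have "\<dots> = (\<Sum>a\<in>B'. real (weight n a)) + real (card B)"
      by (simp add: B'_def sum.distrib sum.reindex[OF inj])
    finally have WB: "(\<Sum>a\<in>B. real (weight n a)) =
        (\<Sum>a\<in>B'. real (weight n a)) + real (card B)" .
    have "(\<Sum>a\<in>A. real (weight n a)) =
        (\<Sum>a\<in>B. real (weight n a)) + (\<Sum>a\<in>C. real (weight n a))"
      unfolding union by (rule sum.union_disjoint[OF finB finC disj])
    \<comment> \<open>The lost units contribute \<open>2 * card B\<close> to the doubled sum,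
      exactly the surplus in the superadditivity bound.\<close>
    then show ?thesis
      using WB IHB IHC mult_log2_superadditive[of "real (card B)" "real (card C)"] b bc cardA
      by simp
  qed
qed

theorem theorem1p7:
  fixes n :: nat and A :: "(nat \<Rightarrow> nat) set"
  assumes "n \<ge> 1"
    and "finite A" and "A \<noteq> {}" and "is_downset n A"
  shows "1 / real (card A) * (\<Sum>a\<in>A. real (weight n a)) \<le> 1 / 2 * log 2 (real (card A))"
proof -
  have "0 < card A" using assms by (simp add: card_gt_0_iff)
  then show ?thesis
    using sum_weight_downset_le[OF assms(2-4)] by (simp add: field_simps)
qed

end
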